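(* Let $\mathcal{F}_8$ be the class of functions $f\in\mathcal{A}$ such that $\left|f'(z)/g'(z)-1\right|<1$ for all $z\in\mathbb{D}$, for some convex function $g\in\mathcal{A}$. Then the following radius results hold: (a) for every $0\le\alpha<1$, the $\mathcal{C}(\alpha)$-radius of $\mathcal{F}_8$ is $R_{\mathcal{C}(\alpha)}(\mathcal{F}_8)=\dfrac{2(1-\alpha)}{3+\sqrt{9+4\alpha(\alpha-1)}}$; (b) the $\mathcal{UCV}$-radius of $\mathcal{F}_8$ is $R_{\mathcal{UCV}}(\mathcal{F}_8)=R_{\mathcal{C}(1/2)}(\mathcal{F}_8)=3-2\sqrt2$. The results are sharp (i.e. each radius is exactly equal to the stated value).
   Context: $\mathbb{D}=\{z\in\mathbb{C}:|z|<1\}$. $\mathcal{A}$ is the class of analytic functions $f$ on $\mathbb{D}$ with $f(0)=0$ and $f'(0)=1$; $\mathcal{S}\subset\mathcal{A}$ is the subclass of univalent (injective) functions. A convex function $g\in\mathcal{A}$ is a function $g\in\mathcal{S}$ with $\operatorname{Re}(1+zg''(z)/g'(z))>0$ on $\mathbb{D}$. For $0\le\alpha<1$, $\mathcal{C}(\alpha)$ is the class of $f\in\mathcal{S}$ with $\operatorname{Re}(1+zf''(z)/f'(z))>\alpha$ on $\mathbb{D}$ (convex of order $\alpha$). $\mathcal{UCV}$ is the class of uniformly convex functions: $f\in\mathcal{S}$ such that for every circular arc $\gamma\subset\mathbb{D}$ with center $\zeta\in\mathbb{D}$ the image arc $f(\gamma)$ is convex; by a known theorem of Rønning and of Ma and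 Minda, $f\in\mathcal{UCV}$ if and only if $\operatorname{Re}\left(1+zf''(z)/f'(z)\right)>\left|zf''(z)/f'(z)\right|$ for all $z\in\mathbb{D}$. For families $\mathcal{G},\mathcal{F}\subset\mathcal{A}$, the $\mathcal{G}$-radius of $\mathcal{F}$, denoted $R_{\mathcal{G}}(\mathcal{F})$, is the largest number $R$ such that the function $z\mapsto r^{-1}f(rz)$ belongs to $\mathcal{G}$ for all $0<r\le R$ and all $f\in\mathcal{F}$. *)

theory Defs
  imports "HOL-Complex_Analysis.Complex_Analysis"
begin

text \<open>
  Functions on the unit disc are total functions on the complex plane; only their values on
  \<^term>\<open>ball 0 1 :: complex set\<close> matter for membership in the classes below.
\<close>

definition class_A :: "(complex \<Rightarrow> complex) set" where
  "class_A = {f. f holomorphic_on ball 0 1 \<and> f 0 = 0 \<and> deriv f 0 = 1}"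

definition class_S :: "(complex \<Rightarrow> complex) set" where
  "class_S = {f \<in> class_A. inj_on f (ball 0 1)}"

text \<open>The derivative of a univalent function has no zeros, so no division by zero occurs here.\<close>

definition convex_of_order :: "real \<Rightarrow> (complex \<Rightarrow> complex) set" where
  "convex_of_order \<alpha> =
     {f \<in> class_S. \<forall>z\<in>ball 0 1. Re (1 + z * deriv (deriv f) z / deriv f z) > \<alpha>}"

definition convex_functions :: "(complex \<Rightarrow> complex) set" where
  "convex_functions =
     {g \<in> class_S. \<forall>z\<in>ball 0 1. Re (1 + z * deriv (deriv g) z / deriv g z) > 0}"

text \<open>
  Goodman's notion of a convex arc: a regular arc along which (a continuous branch of) the argument
  of the tangent vector is nondecreasing. The sense of traversal matters: a circle run through
  clockwise is not a convex arc.
\<close>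

definition convex_arc :: "(real \<Rightarrow> complex) \<Rightarrow> bool" where
  "convex_arc \<Gamma> \<longleftrightarrow>
     (\<exists>\<theta> :: real \<Rightarrow> real. continuous_on {0..1} \<theta> \<and> mono_on {0..1} \<theta> \<and>
        (\<forall>t\<in>{0..1}. \<exists>s>0.
           (\<Gamma> has_vector_derivative of_real s * cis (\<theta> t)) (at t within {0..1})))"

text \<open>Uniformly convex functions; circular arcs (up to full circles) are run through
  counterclockwise.\<close>

definition class_UCV :: "(complex \<Rightarrow> complex) set" where
  "class_UCV =
     {f \<in> class_S. \<forall>\<zeta>\<in>ball 0 1. \<forall>\<rho>>0. \<forall>a b. a < b \<longrightarrow> b \<le> a + 2 * pi \<longrightarrow>
        path_image (part_circlepath \<zeta> \<rho> a b) \<subseteq> ball 0 1 \<longrightarrow>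
        convex_arc (f \<circ> part_circlepath \<zeta> \<rho> a b)}"

text \<open>
  \<open>is_radius \<G> \<F> R\<close> says that \<open>R\<close> is the largest admissible number, i.e. that the
  \<open>\<G>\<close>-radius of \<open>\<F>\<close> exists and equals \<open>R\<close>. The bound \<open>R \<le> 1\<close> is
  implicit in the usual definition: for \<open>r > 1\<close> the dilation of a function on the unit disc
  is not defined on the whole disc.
\<close>

definition admissible_radius ::
    "(complex \<Rightarrow> complex) set \<Rightarrow> (complex \<Rightarrow> complex) set \<Rightarrow> real \<Rightarrow> bool" where
  "admissible_radius \<G> \<F> R \<longleftrightarrow> R \<le> 1 \<and>
     (\<forall>r f. 0 < r \<longrightarrow> r \<le> R \<longrightarrow> f \<in> \<F> \<longrightarrow> (\<lambda>z. f (of_real r * z) / of_real r) \<in> \<G>)"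

definition is_radius ::
    "(complex \<Rightarrow> complex) set \<Rightarrow> (complex \<Rightarrow> complex) set \<Rightarrow> real \<Rightarrow> bool" where
  "is_radius \<G> \<F> R \<longleftrightarrow>
     admissible_radius \<G> \<F> R \<and> (\<forall>R'. admissible_radius \<G> \<F> R' \<longrightarrow> R' \<le> R)"

lemma is_radius_unique: "is_radius \<G> \<F> R \<Longrightarrow> is_radius \<G> \<F> R' \<Longrightarrow> R = R'"
  unfolding is_radius_def by (meson order_antisym)

definition class_F8 :: "(complex \<Rightarrow> complex) set" where
  "class_F8 =
     {f \<in> class_A. \<exists>g\<in>convex_functions. \<forall>z\<in>ball 0 1. cmod (deriv f z / deriv g z - 1) < 1}"

end

theory Submission
  imports Defs
begin

text \<open>
  Let \<open>f' = g' (1 + w)\<close> with \<open>g\<close> convex and \<open>\<bar>w\<bar> < 1\<close>, \<open>w 0 = 0\<close>, and let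
  \<open>r = \<bar>z\<bar> < 1\<close>. Then \<open>W = 1 + z f'' / f'\<close> is the sum of \<open>1 + z g'' / g'\<close>, a function with
  positive real part and value \<open>1\<close> at the origin, and of \<open>z w' / (1 + w)\<close>. Caratheodory's disc for the
  first and the Schwarz-Pick lemma for the second give (lemma \<open>F8_disc\<close>)
  
    \<open>\<bar>W - (1 + r\<^sup>2) / (1 - r\<^sup>2)\<bar> \<le> (3 r + r\<^sup>2) / (1 - r\<^sup>2)\<close>.
  
  Hence \<open>Re W \<ge> (1 - 3 r) / (1 - r\<^sup>2)\<close>, and this bound exceeds \<open>\<alpha>\<close> exactly for \<open>r\<close> below the
  stated radius (lemma \<open>order_radius\<close>). All the radii are at most \<open>1/3\<close>, and there \<open>f\<close> is
  univalent: the same disc bounds \<open>\<bar>z f'' / f'\<bar>\<close> by \<open>3 r / (1 - r)\<close>, so that the argument of \<open>f'\<close>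
  stays below \<open>3/2 < pi/2\<close> and the Noshiro-Warschawski criterion applies.
  
  For uniform convexity the geometric definition is first turned into the condition
  \<open>Re (1 + (z - \<zeta>) f'' / f') \<ge> 0\<close> for all \<open>z\<close>, \<open>\<zeta>\<close> in the disc (lemma \<open>class_UCV_iff\<close>):
  the left side is the speed at which the argument of the tangent turns along the image of a circle about
  \<open>\<zeta>\<close>. As long as \<open>r < 3 - 2 sqrt 2\<close>, the disc that contains \<open>W\<close> lies inside the parabolic region
  \<open>\<bar>W - 1\<bar> \<le> Re W\<close>. This settles the case \<open>\<bar>\<zeta>\<bar> \<le> \<bar>z\<bar>\<close>, and the minimum principle in
  \<open>z\<close> gives the remaining case. The disc first meets the parabola at the vertex \<open>1/2\<close>, on the real axis,
  which is why the radius is the same as for convexity of order \<open>1/2\<close>.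
  
  The bound for \<open>Re W\<close> is attained by the function with derivative \<open>(1 + z) / (1 - z)\<^sup>2\<close> on the
  negative real axis, where \<open>W = (1 - 3 r) / (1 - r\<^sup>2)\<close>. There the choice \<open>\<zeta> = - z\<close> turns the
  condition for uniform convexity into \<open>Re W \<ge> 1/2\<close>, so the same function is extremal for it.
\<close>

section \<open>Estimates for bounded functions and for functions with positive real part\<close>
lemma Moebius_function_has_field_derivative:
  assumes "norm w < 1" "norm z < 1"
  shows "(Moebius_function 0 w has_field_derivative (1 - cnj w * w) / (1 - cnj w * z)\<^sup>2) (at z)"
proof -
  have "cmod (cnj w * z) < 1"
    using norm_mult_less[of "cnj w" 1 z 1] assms by simp
  then have "1 - cnj w * z \<noteq> 0" by auto
  then show ?thesis
    unfolding Moebius_function_def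
    by (auto intro!: derivative_eq_intros simp: field_simps power2_eq_square)
qed

text \<open>
  Moving \<open>a\<close> and \<open>f a\<close> to the origin by disc automorphisms reduces this to the
  bound on the derivative at the origin in the Schwarz lemma.
\<close>
lemma Schwarz_Pick_deriv:
  assumes holf: "f holomorphic_on ball 0 1"
    and no: "\<And>z. norm z < 1 \<Longrightarrow> norm (f z) < 1"
    and a: "norm a < 1"
  shows "norm (deriv f a) * (1 - (norm a)\<^sup>2) \<le> 1 - (norm (f a))\<^sup>2"
proof -
  define \<phi> where "\<phi> = Moebius_function 0 (-a)"
  define \<psi> where "\<psi> = Moebius_function 0 (f a)"
  have fa: "norm (f a) < 1" using no a by blast
  have na: "norm (-a) < 1" using a by simp
  have \<phi>0: "\<phi> 0 = a" by (simp add: \<phi>_def Moebius_function_of_zero)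
  have \<phi>ball: "norm (\<phi> z) < 1" if "norm z < 1" for z
    using Moebius_function_norm_lt_1[OF na that] by (simp add: \<phi>_def)
  have d\<phi>: "(\<phi> has_field_derivative (1 - cnj a * a)) (at 0)"
    using Moebius_function_has_field_derivative[OF na, of 0] by (simp add: \<phi>_def)
  have df: "(f has_field_derivative deriv f a) (at (\<phi> 0))"
    using holomorphic_derivI[OF holf open_ball] a \<phi>0 by simp
  have nz: "1 - cnj (f a) * f a \<noteq> 0"
    using fa by (simp add: complex_norm_square [symmetric] mult.commute flip: of_real_power)
       (metis abs_norm_cancel abs_square_less_1 less_irrefl of_real_1 of_real_eq_iff of_real_power)
  have d\<psi>: "(\<psi> has_field_derivative 1 / (1 - cnj (f a) * f a)) (at (f (\<phi> 0)))"
    using Moebius_function_has_field_derivative[OF fa fa] nz \<phi>0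
    by (simp add: \<psi>_def power2_eq_square)
  define G where "G = (\<lambda>z. \<psi> (f (\<phi> z)))"
  have dG: "(G has_field_derivative (1 / (1 - cnj (f a) * f a) * (deriv f a * (1 - cnj a * a)))) (at 0)"
    using DERIV_chain2[where f=\<psi> and g="\<lambda>z. f (\<phi> z)", OF d\<psi> DERIV_chain2[OF df d\<phi>]]
    unfolding G_def .
  have "\<phi> holomorphic_on ball 0 1"
    unfolding \<phi>_def by (rule Moebius_function_holomorphic[OF na])
  moreover have "\<psi> holomorphic_on ball 0 1"
    unfolding \<psi>_def by (rule Moebius_function_holomorphic[OF fa])
  ultimately have "(\<psi> \<circ> (f \<circ> \<phi>)) holomorphic_on ball 0 1"
    by (intro holomorphic_on_compose_gen[where t="ball 0 1"] holf) (use \<phi>ball no in auto)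
  then have holG: "G holomorphic_on ball 0 1" by (simp add: G_def o_def)
  have "norm (deriv G 0) \<le> 1"
  proof (rule Schwarz_Lemma(2)[OF holG, of 0])
    show "G 0 = 0" by (simp add: G_def \<phi>0 \<psi>_def Moebius_function_eq_zero)
    show "norm (G z) < 1" if "norm z < 1" for z
      unfolding G_def \<psi>_def by (intro Moebius_function_norm_lt_1 fa no \<phi>ball that)
  qed auto
  moreover have sq: "1 - cnj b * b = of_real (1 - (norm b)\<^sup>2)" for b
    using complex_norm_square[of b] by (simp add: mult.commute)
  have "deriv G 0 = deriv f a * of_real (1 - (norm a)\<^sup>2) / of_real (1 - (norm (f a))\<^sup>2)"
    using DERIV_imp_deriv[OF dG] unfolding sq by simp
  moreover have "1 - (norm a)\<^sup>2 > 0" "1 - (norm (f a))\<^sup>2 > 0"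
    using a fa by (simp_all add: abs_square_less_1)
  ultimately show ?thesis
    by (simp add: norm_mult norm_divide abs_of_pos field_simps del: of_real_diff)
qed

text \<open>
  Schwarz-Pick gives \<open>\<bar>w'\<bar> (1 - r\<^sup>2) \<le> 1 - s\<^sup>2\<close> with \<open>r = \<bar>z\<bar>\<close>, \<open>s = \<bar>w z\<bar>\<close>. One factor
  \<open>1 - s\<close> is absorbed by \<open>\<bar>1 + w z\<bar>\<close>, and the Schwarz lemma bounds the other factor, \<open>1 + s\<close>, by \<open>1 + r\<close>.
\<close>
lemma logarithmic_derivative_one_plus_bound:
  assumes holw: "w holomorphic_on ball 0 1" and w0: "w 0 = 0"
    and no: "\<And>z. norm z < 1 \<Longrightarrow> norm (w z) < 1"
    and z: "norm z < 1"
  shows "norm (z * deriv w z / (1 + w z)) \<le> norm z / (1 - norm z)"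
proof -
  define r s where "r = norm z" and "s = norm (w z)"
  have r: "0 \<le> r" "r < 1" and s: "0 \<le> s" "s < 1" using z no by (auto simp: r_def s_def)
  have sr: "s \<le> r" using Schwarz_Lemma(1)[OF holw w0 no z] by (simp add: r_def s_def)
  have r2: "0 < 1 - r\<^sup>2" using r by (simp add: abs_square_less_1)
  have "1 - s \<le> norm (1 + w z)"
    using norm_triangle_ineq2[of 1 "- w z"] by (simp add: s_def)
  have "norm (deriv w z) * (1 - r\<^sup>2) \<le> (1 + s) * (1 - s)"
    using Schwarz_Pick_deriv[OF holw no z] by (simp add: r_def s_def power2_eq_square algebra_simps)
  also have "\<dots> \<le> (1 + r) * norm (1 + w z)"
    using s sr \<open>1 - s \<le> norm (1 + w z)\<close> by (intro mult_mono) auto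
  finally have "norm (deriv w z) * (1 - r) * (1 + r) \<le> norm (1 + w z) * (1 + r)"
    by (simp add: power2_eq_square algebra_simps)
  then have le: "norm (deriv w z) * (1 - r) \<le> norm (1 + w z)"
    using r by (simp del: distrib_left)
  have "0 < norm (1 + w z)" using \<open>1 - s \<le> norm (1 + w z)\<close> s by linarith
  then have "norm (deriv w z) / norm (1 + w z) \<le> 1 / (1 - r)"
    using le r by (simp add: field_simps)
  from mult_left_mono[OF this r(1)] show ?thesis
    by (simp add: norm_mult norm_divide r_def)
qed

text \<open>
  The Cayley transform of \<open>p\<close> maps the disc into itself and fixes the origin, so it is bounded by
  \<open>\<bar>z\<bar>\<close> by the Schwarz lemma. Pulled back, the disc of radius \<open>\<bar>z\<bar>\<close> about the origin
  becomes the disc below.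
\<close>
lemma Caratheodory_disc:
  assumes holp: "p holomorphic_on ball 0 1" and p0: "p 0 = 1"
    and pos: "\<And>z. norm z < 1 \<Longrightarrow> Re (p z) > 0"
    and z: "norm z < 1"
  shows "norm (p z - of_real ((1 + (norm z)\<^sup>2) / (1 - (norm z)\<^sup>2))) \<le> 2 * norm z / (1 - (norm z)\<^sup>2)"
proof -
  define r where "r = norm z"
  define \<phi> where "\<phi> = (\<lambda>z. (p z - 1) / (p z + 1))"
  have nz: "p z + 1 \<noteq> 0" if "norm z < 1" for z
    using pos[OF that] by (auto simp: complex_eq_iff)
  have r: "0 \<le> r" "r < 1" using z by (auto simp: r_def)
  have r2: "0 < 1 - r\<^sup>2" using r by (simp add: abs_square_less_1)
  have "norm (\<phi> z) \<le> r"
    unfolding r_def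
  proof (rule Schwarz_Lemma(1)[OF _ _ _ z])
    show "\<phi> holomorphic_on ball 0 1"
      unfolding \<phi>_def by (intro holomorphic_intros holp) (use nz in auto)
    show "\<phi> 0 = 0" by (simp add: \<phi>_def p0)
    show "norm (\<phi> z) < 1" if "norm z < 1" for z
    proof -
      have "(norm (p z - 1))\<^sup>2 < (norm (p z + 1))\<^sup>2"
        using pos[OF that] unfolding cmod_power2 by (simp add: power2_eq_square algebra_simps)
      then have "norm (p z - 1) < norm (p z + 1)" by (rule power_less_imp_less_base) simp
      then show ?thesis using nz[OF that] by (simp add: \<phi>_def norm_divide)
    qed
  qed
  then have "norm (p z - 1) \<le> r * norm (p z + 1)"
    using nz[OF z] by (simp add: \<phi>_def norm_divide field_simps)
  then have "(norm (p z - 1))\<^sup>2 \<le> r\<^sup>2 * (norm (p z + 1))\<^sup>2"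
    by (metis norm_ge_zero power_mono power_mult_distrib)
  then have ineq: "(1 - r\<^sup>2) * ((Re (p z))\<^sup>2 + (Im (p z))\<^sup>2 + 1) \<le> 2 * (1 + r\<^sup>2) * Re (p z)"
    unfolding cmod_power2 by (simp add: power2_eq_square algebra_simps)
  define a where "a = (1 + r\<^sup>2) / (1 - r\<^sup>2)"
  have ra: "a * (1 - r\<^sup>2) = 1 + r\<^sup>2" using r2 by (simp add: a_def)
  have "(1 - r\<^sup>2) * ((Re (p z))\<^sup>2 + (Im (p z))\<^sup>2 + 1) \<le> (1 - r\<^sup>2) * (2 * a * Re (p z))"
    using ineq unfolding ra[symmetric] by (simp add: algebra_simps)
  then have "(Re (p z))\<^sup>2 + (Im (p z))\<^sup>2 + 1 \<le> 2 * a * Re (p z)"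
    using r2 by simp
  then have "(norm (p z - of_real a))\<^sup>2 \<le> a\<^sup>2 - 1"
    unfolding cmod_power2 by (simp add: power2_eq_square algebra_simps)
  also have "\<dots> = (2 * r / (1 - r\<^sup>2))\<^sup>2"
    using r2 unfolding a_def power_divide
    by (simp add: divide_simps) (simp add: power2_eq_square algebra_simps)
  finally have "norm (p z - of_real a) \<le> 2 * r / (1 - r\<^sup>2)"
    by (rule power2_le_imp_le) (use r r2 in auto)
  then show ?thesis by (simp add: a_def r_def)
qed

section \<open>Univalence, a minimum principle and a parabolic region\<close>

text \<open>
  By the mean value theorem along the segment from \<open>x\<close> to \<open>y\<close>, the real part of
  \<open>f / (y - x)\<close> is strictly increasing on that segment.
\<close>
lemma Noshiro_Warschawski:
  assumes "convex S" and df: "\<And>z. z \<in> S \<Longrightarrow> (f has_field_derivative f' z) (at z)"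
    and pos: "\<And>z. z \<in> S \<Longrightarrow> Re (f' z) > 0"
  shows "inj_on f S"
proof (rule ccontr)
  assume "\<not> inj_on f S"
  then obtain x y where xy: "x \<in> S" "y \<in> S" "f x = f y" "x \<noteq> y"
    by (auto simp: inj_on_def)
  have sub: "closed_segment x y \<subseteq> S" using \<open>convex S\<close> xy by (simp add: closed_segment_subset)
  have "\<exists>u. u \<in> closed_segment x y \<and>
      Re (f y / (y - x)) - Re (f x / (y - x)) = Re (f' u / (y - x) * (y - x))"
    by (rule complex_mvt_line) (use sub df xy(4) in \<open>auto intro!: DERIV_cdivide\<close>)
  then obtain u where "u \<in> S" "Re (f' u) = 0" using xy sub by auto
  then show False using pos by force
qed

text \<open>
  The maximum modulus principle for \<open>exp (- H)\<close>, whose modulus is \<open>exp (- Re H)\<close>.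
\<close>
lemma Re_nonneg_minimum_principle:
  assumes holH: "H holomorphic_on U" and "open U" and sub: "cball 0 s \<subseteq> U"
    and bd: "\<And>u. norm u = s \<Longrightarrow> Re (H u) \<ge> 0"
    and u: "norm u \<le> s"
  shows "Re (H u) \<ge> 0"
proof -
  have hol: "(\<lambda>u. exp (- H u)) holomorphic_on U" by (intro holomorphic_intros holH)
  have "norm (exp (- H u)) \<le> 1"
  proof (rule maximum_modulus_frontier[of "\<lambda>u. exp (- H u)" "cball 0 s"])
    show "(\<lambda>u. exp (- H u)) holomorphic_on interior (cball 0 s)"
      using hol sub by (meson holomorphic_on_subset interior_subset subset_trans)
    show "continuous_on (closure (cball 0 s)) (\<lambda>u. exp (- H u))"
      using hol sub by (simp add: holomorphic_on_imp_continuous_on holomorphic_on_subset)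
  qed (use bd u in \<open>auto simp: sphere_def frontier_def interior_cball\<close>)
  then show ?thesis by simp
qed

text \<open>
  The region \<open>\<bar>W - 1\<bar> \<le> Re W\<close> is bounded by the parabola \<open>y\<^sup>2 = 2 x - 1\<close>. For a centre
  \<open>a \<le> 3/2\<close> on the real axis the nearest point of the parabola is its vertex \<open>1/2\<close>, so the disc of
  radius \<open>a - 1/2\<close> stays inside. Beyond \<open>3/2\<close> the disc would cross the parabola off the axis.
\<close>
lemma disc_inside_parabola:
  assumes W: "norm (W - of_real a) \<le> a - 1/2" and a: "a \<le> 3/2"
  shows "norm (W - 1) \<le> Re W"
proof -
  define x y where "x = Re W" and "y = Im W"
  have "\<bar>x - a\<bar> \<le> a - 1/2"
    using abs_Re_le_cmod[of "W - of_real a"] W by (simp add: x_def)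
  then have x: "1/2 \<le> x" by linarith
  have "(norm (W - of_real a))\<^sup>2 \<le> (a - 1/2)\<^sup>2" using W by (simp add: power_mono)
  then have "y\<^sup>2 \<le> (x - 1/2) * (2 * a - 1/2 - x)"
    unfolding cmod_power2 by (simp add: x_def y_def power2_eq_square algebra_simps)
  also have "\<dots> \<le> (x - 1/2) * 2" using x a by (intro mult_left_mono) auto
  finally have "(norm (W - 1))\<^sup>2 \<le> (Re W)\<^sup>2"
    unfolding cmod_power2 by (simp add: x_def y_def power2_eq_square algebra_simps)
  then show ?thesis by (rule power2_le_imp_le) (use x in \<open>simp add: x_def\<close>)
qed

lemma logarithm_of_derivative_exists:
  assumes "convex A" "open A" "z0 \<in> A" and holf: "f holomorphic_on A"
    and nz: "\<And>z. z \<in> A \<Longrightarrow> deriv f z \<noteq> 0"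
  obtains h where "\<And>z. z \<in> A \<Longrightarrow> exp (h z) = deriv f z"
    and "\<And>z. z \<in> A \<Longrightarrow> (h has_field_derivative deriv (deriv f) z / deriv f z) (at z)"
proof -
  have hol': "deriv f holomorphic_on A" by (intro holomorphic_deriv holf \<open>open A\<close>)
  obtain h where holh: "h holomorphic_on A" and h: "\<And>z. z \<in> A \<Longrightarrow> exp (h z) = deriv f z"
    using holomorphic_logarithm_exists[OF assms(1,2) hol' nz \<open>z0 \<in> A\<close>] by blast
  have "(h has_field_derivative deriv (deriv f) z / deriv f z) (at z)" if z: "z \<in> A" for z
  proof -
    have dh: "(h has_field_derivative deriv h z) (at z)" by (rule holomorphic_derivI[OF holh \<open>open A\<close> z])
    have "((\<lambda>z. exp (h z)) has_field_derivative deriv (deriv f) z) (at z)"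
      by (rule has_field_derivative_transform_within_open[OF holomorphic_derivI[OF hol' \<open>open A\<close> z] \<open>open A\<close> z])
        (simp add: h)
    moreover have "((\<lambda>z. exp (h z)) has_field_derivative exp (h z) * deriv h z) (at z)"
      by (rule derivative_eq_intros dh refl)+
    ultimately have "deriv (deriv f) z = deriv f z * deriv h z"
      using DERIV_unique h[OF z] by metis
    then have "deriv h z = deriv (deriv f) z / deriv f z" using nz z by simp
    then show ?thesis using dh by simp
  qed
  with h that show thesis by blast
qed

text \<open>
  Write \<open>f' = exp h\<close> with \<open>h 0 = 0\<close>. The mean value theorem along the radius to \<open>z\<close> bounds
  \<open>Im (h z)\<close> by \<open>3 \<bar>z\<bar> / (1 - \<bar>z\<bar>) \<le> 3/2 < pi/2\<close>. Hence \<open>f'\<close> has positive real part.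
\<close>
lemma univalent_on_third_disc:
  assumes holf: "f holomorphic_on ball 0 1"
    and nz: "\<And>z. norm z < 1 \<Longrightarrow> deriv f z \<noteq> 0" and f1: "deriv f 0 = 1"
    and bd: "\<And>z. norm z < 1 \<Longrightarrow> norm (z * deriv (deriv f) z / deriv f z) \<le> 3 * norm z / (1 - norm z)"
  shows "inj_on f (ball 0 (1/3))"
proof -
  obtain k where k: "\<And>z. z \<in> ball 0 1 \<Longrightarrow> exp (k z) = deriv f z"
    and dk: "\<And>z. z \<in> ball 0 1 \<Longrightarrow> (k has_field_derivative deriv (deriv f) z / deriv f z) (at z)"
    using logarithm_of_derivative_exists[OF convex_ball open_ball _ holf, of 0] nz by auto
  define h where "h z = k z - k 0" for z
  have h: "exp (h z) = deriv f z" if "z \<in> ball 0 1" for z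
    using k[OF that] k[of 0] f1 by (simp add: h_def exp_diff)
  have dh: "(h has_field_derivative deriv (deriv f) z / deriv f z) (at z)" if z: "z \<in> ball 0 1" for z
    unfolding h_def using DERIV_diff[OF dk[OF z] DERIV_const] by simp
  have Im_h: "\<bar>Im (h z)\<bar> < 3/2" if z: "norm z < 1/3" for z
  proof -
    define \<gamma> where "\<gamma> t = Im (h (of_real t * z))" for t :: real
    define q where "q u = deriv (deriv f) u / deriv f u" for u
    have in1: "of_real t * z \<in> ball 0 1" if "0 \<le> t" "t \<le> 1" for t :: real
      using that z mult_left_le_one_le[of "norm z" t] by (simp add: norm_mult)
    have d\<gamma>: "(\<gamma> has_real_derivative Im (z * q (of_real t * z))) (at t)" if "0 \<le> t" "t \<le> 1" for t
    proof -
      have "((\<lambda>t. of_real t * z) has_vector_derivative z) (at t)"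
        by (auto intro!: derivative_eq_intros)
      from field_vector_diff_chain_at[OF this dh[OF in1[OF that]]]
      have "((\<lambda>t. h (of_real t * z)) has_vector_derivative z * q (of_real t * z)) (at t)"
        by (simp add: o_def q_def)
      from bounded_linear.has_vector_derivative[OF bounded_linear_Im this]
      show ?thesis unfolding \<gamma>_def by (simp add: has_real_derivative_iff_has_vector_derivative)
    qed
    \<comment> \<open>The mean value point satisfies \<open>\<xi> > 0\<close>, so \<open>bd\<close> at \<open>\<xi> z\<close>, a bound on
      \<open>\<bar>\<xi> z q\<bar>\<close>, may be divided by \<open>\<xi>\<close>.\<close>
    obtain \<xi> where \<xi>: "0 < \<xi>" "\<xi> < 1" "\<gamma> 1 - \<gamma> 0 = (1 - 0) * Im (z * q (of_real \<xi> * z))"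
      using MVT2[of 0 1 \<gamma> "\<lambda>t. Im (z * q (of_real t * z))"] d\<gamma> by auto
    have "\<gamma> 0 = 0" by (simp add: \<gamma>_def h_def)
    have \<xi>z: "\<xi> * norm z < 1/3" 
      using \<xi> z mult_left_le_one_le[of "norm z" \<xi>] by simp
    have "\<xi> * norm (z * q (of_real \<xi> * z)) \<le> \<xi> * (3 * norm z / (1 - \<xi> * norm z))"
      using bd[of "of_real \<xi> * z"] \<xi> \<xi>z by (simp add: norm_mult q_def norm_divide mult_ac)
    then have "norm (z * q (of_real \<xi> * z)) \<le> 3 * norm z / (1 - \<xi> * norm z)"
      using \<xi> mult_le_cancel_left_pos by blast
    also have "\<dots> < 3/2"
      using \<xi>z z by (simp add: divide_simps)
    finally have "norm (z * q (of_real \<xi> * z)) < 3/2" .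
    then show ?thesis
      using abs_Im_le_cmod[of "z * q (of_real \<xi> * z)"] \<xi>(3) \<open>\<gamma> 0 = 0\<close> by (simp add: \<gamma>_def)
  qed
  show ?thesis
  proof (rule Noshiro_Warschawski[where f' = "deriv f"])
    fix z :: complex assume "z \<in> ball 0 (1/3)"
    then have z: "norm z < 1/3" and z1: "z \<in> ball 0 1" by auto
    show "(f has_field_derivative deriv f z) (at z)" by (rule holomorphic_derivI[OF holf open_ball z1])
    have "cos (Im (h z)) > 0"
      using Im_h[OF z] pi_gt3 by (intro cos_gt_zero_pi) auto
    then show "Re (deriv f z) > 0" by (simp add: h[OF z1, symmetric] Re_exp)
  qed simp
qed

section \<open>The differential characterization of uniform convexity\<close>
lemma part_circlepath_has_vector_derivative:
  "(part_circlepath \<zeta> \<rho> a b has_vector_derivative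
     \<i> * of_real (b - a) * (part_circlepath \<zeta> \<rho> a b t - \<zeta>)) (at t)"
  using has_vector_derivative_part_circlepath[of \<zeta> \<rho> a b t UNIV]
  by (simp add: part_circlepath_def mult_ac)

lemma image_of_part_circlepath_has_vector_derivative:
  assumes holf: "f holomorphic_on ball 0 1" and "part_circlepath \<zeta> \<rho> a b t \<in> ball 0 1"
  shows "((f \<circ> part_circlepath \<zeta> \<rho> a b) has_vector_derivative
          \<i> * of_real (b - a) * (part_circlepath \<zeta> \<rho> a b t - \<zeta>) *
            deriv f (part_circlepath \<zeta> \<rho> a b t)) (at t)"
  by (rule field_vector_diff_chain_at[OF part_circlepath_has_vector_derivative
        holomorphic_derivI[OF holf open_ball assms(2)]])

text \<open>
  With \<open>f' = exp h\<close>, the tangent of the image of the arc at \<open>z\<close> has argument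
  \<open>Im (h z) + pi/2 + \<phi>\<close>, where \<open>\<phi>\<close> is the angle on the circle. Its derivative with respect
  to \<open>\<phi>\<close> is exactly the quantity assumed to be nonnegative.
\<close>
lemma convex_arc_if_curvature_nonneg:
  assumes holf: "f holomorphic_on ball 0 1"
    and nz: "\<And>z. norm z < 1 \<Longrightarrow> deriv f z \<noteq> 0"
    and \<rho>: "\<rho> > 0" and ab: "a < b"
    and arc: "path_image (part_circlepath \<zeta> \<rho> a b) \<subseteq> ball 0 1"
    and pos: "\<And>z. norm z < 1 \<Longrightarrow> Re (1 + (z - \<zeta>) * deriv (deriv f) z / deriv f z) \<ge> 0"
  shows "convex_arc (f \<circ> part_circlepath \<zeta> \<rho> a b)"
proof -
  define \<gamma> where "\<gamma> = part_circlepath \<zeta> \<rho> a b"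
  obtain h where h: "\<And>z. z \<in> ball 0 1 \<Longrightarrow> exp (h z) = deriv f z"
    and dh: "\<And>z. z \<in> ball 0 1 \<Longrightarrow> (h has_field_derivative deriv (deriv f) z / deriv f z) (at z)"
    using logarithm_of_derivative_exists[OF convex_ball open_ball _ holf, of 0] nz by auto
  have in1: "\<gamma> t \<in> ball 0 1" if "t \<in> {0..1}" for t
    using arc that unfolding path_image_def \<gamma>_def by blast
  define \<theta> where "\<theta> t = Im (h (\<gamma> t)) + pi/2 + linepath a b t" for t
  have d\<theta>: "(\<theta> has_real_derivative
      (b - a) * Re (1 + (\<gamma> t - \<zeta>) * deriv (deriv f) (\<gamma> t) / deriv f (\<gamma> t))) (at t)"
    if t: "t \<in> {0..1}" for t
  proof -
    define q where "q = deriv (deriv f) (\<gamma> t) / deriv f (\<gamma> t)"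
    have d\<gamma>: "(\<gamma> has_vector_derivative \<i> * of_real (b - a) * (\<gamma> t - \<zeta>)) (at t)"
      unfolding \<gamma>_def by (rule part_circlepath_has_vector_derivative)
    have "((\<lambda>t. h (\<gamma> t)) has_vector_derivative \<i> * of_real (b - a) * (\<gamma> t - \<zeta>) * q) (at t)"
      using field_vector_diff_chain_at[OF d\<gamma> dh[OF in1[OF t]]] by (simp add: q_def o_def)
    from bounded_linear.has_vector_derivative[OF bounded_linear_Im this]
    have "((\<lambda>t. Im (h (\<gamma> t))) has_real_derivative Im (\<i> * of_real (b - a) * (\<gamma> t - \<zeta>) * q)) (at t)"
      by (simp add: has_real_derivative_iff_has_vector_derivative)
    moreover have "((\<lambda>t. pi/2 + linepath a b t) has_real_derivative b - a) (at t)"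
      unfolding linepath_def by (auto intro!: derivative_eq_intros)
    ultimately have "(\<theta> has_real_derivative
        Im (\<i> * of_real (b - a) * (\<gamma> t - \<zeta>) * q) + (b - a)) (at t)"
      unfolding \<theta>_def add.assoc by (rule DERIV_add)
    also have "Im (\<i> * of_real (b - a) * (\<gamma> t - \<zeta>) * q) + (b - a) = (b - a) * Re (1 + (\<gamma> t - \<zeta>) * q)"
      by (simp add: algebra_simps)
    finally show ?thesis by (simp add: q_def)
  qed
  have "continuous_on {0..1} \<theta>"
    by (intro continuous_at_imp_continuous_on ballI) (use d\<theta> DERIV_isCont in blast)
  moreover have "mono_on {0..1} \<theta>"
  proof (rule mono_onI)
    fix x y :: real assume xy: "x \<in> {0..1}" "y \<in> {0..1}" "x \<le> y"
    show "\<theta> x \<le> \<theta> y"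
    proof (rule DERIV_nonneg_imp_nondecreasing[OF xy(3)])
      fix t assume "x \<le> t" "t \<le> y"
      then have t: "t \<in> {0..1}" using xy by auto
      have "0 \<le> (b - a) * Re (1 + (\<gamma> t - \<zeta>) * deriv (deriv f) (\<gamma> t) / deriv f (\<gamma> t))"
        using ab pos[of "\<gamma> t"] in1[OF t] by (intro mult_nonneg_nonneg) auto
      then show "\<exists>y. (\<theta> has_real_derivative y) (at t) \<and> 0 \<le> y" using d\<theta>[OF t] by blast
    qed
  qed
  moreover have "\<exists>s>0. ((f \<circ> \<gamma>) has_vector_derivative of_real s * cis (\<theta> t)) (at t within {0..1})"
    if t: "t \<in> {0..1}" for t
  proof (intro exI conjI)
    show "exp (Re (h (\<gamma> t))) * \<rho> * (b - a) > 0" using \<rho> ab by simp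
    have "of_real (exp (Re (h (\<gamma> t))) * \<rho> * (b - a)) * cis (\<theta> t)
        = (of_real (exp (Re (h (\<gamma> t)))) * cis (Im (h (\<gamma> t)))) * cis (pi/2) * of_real (b - a) *
            (of_real \<rho> * cis (linepath a b t))"
      by (simp add: \<theta>_def flip: cis_mult)
    also have "\<dots> = deriv f (\<gamma> t) * \<i> * of_real (b - a) * (\<gamma> t - \<zeta>)"
      unfolding h[OF in1[OF t], symmetric] exp_eq_polar[of "h (\<gamma> t)"]
      by (simp add: \<gamma>_def part_circlepath_def flip: cis_conv_exp)
    finally have eq: "of_real (exp (Re (h (\<gamma> t))) * \<rho> * (b - a)) * cis (\<theta> t) =
      \<i> * of_real (b - a) * (\<gamma> t - \<zeta>) * deriv f (\<gamma> t)" by (simp add: mult_ac)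
    show "((f \<circ> \<gamma>) has_vector_derivative
        of_real (exp (Re (h (\<gamma> t))) * \<rho> * (b - a)) * cis (\<theta> t)) (at t within {0..1})"
      unfolding eq using image_of_part_circlepath_has_vector_derivative[OF holf in1[OF t, unfolded \<gamma>_def]]
      unfolding \<gamma>_def[symmetric] by (rule has_vector_derivative_at_within)
  qed
  ultimately show ?thesis unfolding convex_arc_def \<gamma>_def by blast
qed

text \<open>
  The monotone argument \<open>\<theta>\<close> of the tangent vector \<open>T\<close> is only continuous, so the proof
  differentiates \<open>G t = Im (T t * cnj (T 0))\<close>, a positive multiple of \<open>sin (\<theta> t - \<theta> 0)\<close>. While
  \<open>\<theta>\<close> has increased by less than \<open>pi\<close>, \<open>G\<close> is nonnegative, whereas \<open>G 0 = 0\<close> and the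
  derivative of \<open>G\<close> at \<open>0\<close> is a positive multiple of the quantity in question.
\<close>
lemma curvature_nonneg_if_convex_arc:
  assumes holf: "f holomorphic_on ball 0 1"
    and nz: "\<And>z. norm z < 1 \<Longrightarrow> deriv f z \<noteq> 0"
    and \<rho>: "\<rho> > 0" and ab: "a < b"
    and arc: "path_image (part_circlepath \<zeta> \<rho> a b) \<subseteq> ball 0 1"
    and conv: "convex_arc (f \<circ> part_circlepath \<zeta> \<rho> a b)"
    and z: "z = part_circlepath \<zeta> \<rho> a b 0"
  shows "Re (1 + (z - \<zeta>) * deriv (deriv f) z / deriv f z) \<ge> 0"
proof (rule ccontr)
  assume neg: "\<not> ?thesis"
  define \<gamma> where "\<gamma> = part_circlepath \<zeta> \<rho> a b"
  have in1: "\<gamma> t \<in> ball 0 1" if "t \<in> {0..1}" for t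
    using arc that unfolding path_image_def \<gamma>_def by blast
  have \<gamma>0: "\<gamma> 0 = z" by (simp add: z \<gamma>_def)
  have z1: "z \<in> ball 0 1" using in1[of 0] \<gamma>0 by simp
  define T where "T t = \<i> * of_real (b - a) * (\<gamma> t - \<zeta>) * deriv f (\<gamma> t)" for t
  define G where "G t = Im (T t * cnj (T 0))" for t
  obtain \<theta> where cont\<theta>: "continuous_on {0..1} \<theta>" and mono\<theta>: "mono_on {0..1} \<theta>"
    and \<theta>: "\<And>t. t \<in> {0..1} \<Longrightarrow> \<exists>s>0. ((f \<circ> \<gamma>) has_vector_derivative of_real s * cis (\<theta> t)) (at t within {0..1})"
    using conv unfolding convex_arc_def \<gamma>_def by blast
  have T: "\<exists>s>0. T t = of_real s * cis (\<theta> t)" if t: "t \<in> {0..1}" for t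
  proof -
    obtain s where s: "s > 0" "((f \<circ> \<gamma>) has_vector_derivative of_real s * cis (\<theta> t)) (at t within {0..1})"
      using \<theta>[OF t] by blast
    have "((f \<circ> \<gamma>) has_vector_derivative T t) (at t within {0..1})"
      using image_of_part_circlepath_has_vector_derivative[OF holf in1[OF t, unfolded \<gamma>_def]]
      unfolding \<gamma>_def[symmetric] T_def by (rule has_vector_derivative_at_within)
    then show ?thesis
      using vector_derivative_unique_within_closed_interval[of 0 1 t "f \<circ> \<gamma>"] s t by auto
  qed
  define q where "q = deriv (deriv f) z / deriv f z"
  have d\<gamma>: "(\<gamma> has_vector_derivative \<i> * of_real (b - a) * (z - \<zeta>)) (at 0)"
    unfolding \<gamma>_def z by (rule part_circlepath_has_vector_derivative)
  have df': "(deriv f has_field_derivative q * deriv f z) (at (\<gamma> 0))"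
    using holomorphic_derivI[OF holomorphic_deriv[OF holf open_ball] open_ball z1] nz[of z] z1 \<gamma>0
    by (simp add: q_def)
  have "((\<lambda>t. deriv f (\<gamma> t)) has_vector_derivative \<i> * of_real (b - a) * (z - \<zeta>) * (q * deriv f z)) (at 0)"
    using field_vector_diff_chain_at[OF d\<gamma> df'] by (simp add: o_def)
  from has_vector_derivative_mult[OF has_vector_derivative_diff[OF d\<gamma> has_vector_derivative_const[of \<zeta>]] this]
  have "((\<lambda>t. (\<gamma> t - \<zeta>) * deriv f (\<gamma> t)) has_vector_derivative
      \<i> * of_real (b - a) * (z - \<zeta>) * deriv f z * (1 + (z - \<zeta>) * q)) (at 0)"
    by (simp add: \<gamma>0 algebra_simps)
  from has_vector_derivative_mult_right[OF this, of "\<i> * of_real (b - a)"]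
  have "(T has_vector_derivative T 0 * (\<i> * of_real (b - a) * (1 + (z - \<zeta>) * q))) (at 0)"
    unfolding T_def by (simp add: mult_ac \<gamma>0)
  from has_vector_derivative_mult_left[OF this, of "cnj (T 0)"]
  have "((\<lambda>t. T t * cnj (T 0)) has_vector_derivative
      of_real ((norm (T 0))\<^sup>2) * (\<i> * of_real (b - a) * (1 + (z - \<zeta>) * q))) (at 0)"
    unfolding complex_norm_square by (simp add: mult_ac)
  from bounded_linear.has_vector_derivative[OF bounded_linear_Im this]
  have dG: "(G has_real_derivative (norm (T 0))\<^sup>2 * ((b - a) * Re (1 + (z - \<zeta>) * q))) (at 0)"
    unfolding G_def has_real_derivative_iff_has_vector_derivative by simp
  obtain s0 where s0: "s0 > 0" "T 0 = of_real s0 * cis (\<theta> 0)" using T[of 0] by auto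
  then have "T 0 \<noteq> 0" by simp
  then have "(norm (T 0))\<^sup>2 * ((b - a) * Re (1 + (z - \<zeta>) * q)) < 0"
    using ab neg by (intro mult_pos_neg) (auto simp: q_def)
  from DERIV_neg_dec_right[OF dG this]
  obtain d where d: "d > 0" "\<And>t. 0 < t \<Longrightarrow> t < d \<Longrightarrow> G t < G 0" by auto
  have G0: "G 0 = 0" by (simp add: G_def)
  obtain e where e: "e > 0" "\<And>t. t \<in> {0..1} \<Longrightarrow> dist t 0 < e \<Longrightarrow> dist (\<theta> t) (\<theta> 0) < pi"
    using cont\<theta> pi_gt_zero unfolding continuous_on_iff by (metis atLeastAtMost_iff order_refl zero_le_one)
  define t where "t = min 1 (min (d/2) (e/2))"
  have t: "t \<in> {0..1}" "0 < t" "t < d" "t < e" using d e by (auto simp: t_def)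
  have "0 \<le> \<theta> t - \<theta> 0" using mono\<theta> t by (auto dest: mono_onD[of _ _ 0 t])
  moreover have "\<theta> t - \<theta> 0 < pi" using e(2)[of t] t by (auto simp: dist_real_def)
  ultimately have "0 \<le> sin (\<theta> t - \<theta> 0)" by (intro sin_ge_zero) auto
  moreover obtain s where s: "s > 0" "T t = of_real s * cis (\<theta> t)" using T[OF t(1)] by auto
  have "G t = s * s0 * sin (\<theta> t - \<theta> 0)"
    unfolding G_def s s0 by (simp add: sin_diff algebra_simps)
  ultimately have "G t \<ge> 0" using s(1) s0(1) by simp
  then show False using d(2)[of t] t G0 by simp
qed

lemma class_S_deriv_nonzero:
  assumes "f \<in> class_S" "norm z < 1"
  shows "deriv f z \<noteq> 0"
  using assms holomorphic_injective_imp_regular[of f "ball 0 1" z]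
  by (auto simp: class_S_def class_A_def)

text \<open>
  Goodman's analytic form of uniform convexity. For necessity, every pair of distinct points
  \<open>z\<close>, \<open>\<zeta>\<close> is realized by a short arc about \<open>\<zeta>\<close> that starts at \<open>z\<close>; the starting
  point may be used because \<open>convex_arc\<close> includes one-sided derivatives at the endpoints.
\<close>
lemma class_UCV_iff:
  "f \<in> class_UCV \<longleftrightarrow> f \<in> class_S \<and>
    (\<forall>z\<in>ball 0 1. \<forall>\<zeta>\<in>ball 0 1. Re (1 + (z - \<zeta>) * deriv (deriv f) z / deriv f z) \<ge> 0)"
  (is "_ \<longleftrightarrow> _ \<and> ?R")
proof (intro iffI conjI)
  assume f: "f \<in> class_UCV"
  then show S: "f \<in> class_S" by (simp add: class_UCV_def)
  then have holf: "f holomorphic_on ball 0 1" by (simp add: class_S_def class_A_def)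
  show ?R
  proof (intro ballI)
    fix z \<zeta> :: complex assume z: "z \<in> ball 0 1" and \<zeta>: "\<zeta> \<in> ball 0 1"
    show "Re (1 + (z - \<zeta>) * deriv (deriv f) z / deriv f z) \<ge> 0"
    proof (cases "z = \<zeta>")
      case False
      define \<rho> a where "\<rho> = norm (z - \<zeta>)" and "a = Arg (z - \<zeta>)"
      have \<rho>: "\<rho> > 0" using False by (simp add: \<rho>_def)
      define c where "c \<phi> = \<zeta> + of_real \<rho> * exp (\<i> * of_real \<phi>)" for \<phi> :: real
      have ca: "c a = z"
        using Arg_eq[of "z - \<zeta>"] False by (simp add: c_def \<rho>_def a_def)
      have "continuous_on UNIV c" unfolding c_def by (intro continuous_intros)
      then have "open (c -` ball 0 1)" by (simp add: open_vimage)
      moreover have "a \<in> c -` ball 0 1" using ca z by simp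
      ultimately obtain e where e: "e > 0" "ball a e \<subseteq> c -` ball 0 1"
        by (meson open_contains_ball)
      \<comment> \<open>The cap \<open>1\<close> keeps the arc shorter than a full turn.\<close>
      define b where "b = a + min 1 (e/2)"
      have ab: "a < b" "b \<le> a + 1" "b < a + e" using e by (auto simp: b_def)
      have arc: "path_image (part_circlepath \<zeta> \<rho> a b) \<subseteq> ball 0 1"
      proof -
        have "c \<phi> \<in> ball 0 1" if "a \<le> \<phi>" "\<phi> \<le> b" for \<phi>
        proof -
          have "\<phi> \<in> ball a e" using that ab by (simp add: dist_real_def)
          then show ?thesis using e by blast
        qed
        then show ?thesis
          using ab(1) by (auto simp: path_image_part_circlepath c_def)
      qed
      have "convex_arc (f \<circ> part_circlepath \<zeta> \<rho> a b)"
        using f \<zeta> \<rho> ab arc pi_gt3 by (auto simp: class_UCV_def)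
      moreover have "z = part_circlepath \<zeta> \<rho> a b 0"
        using ca by (simp add: c_def part_circlepath_def linepath_def)
      ultimately show ?thesis
        using curvature_nonneg_if_convex_arc[OF holf class_S_deriv_nonzero[OF S] \<rho> ab(1) arc] by blast
    qed simp
  qed
next
  assume "f \<in> class_S \<and> ?R"
  then have S: "f \<in> class_S" and R: ?R by auto
  then have holf: "f holomorphic_on ball 0 1" by (simp add: class_S_def class_A_def)
  show "f \<in> class_UCV"
    unfolding class_UCV_def
    using S R convex_arc_if_curvature_nonneg[OF holf class_S_deriv_nonzero[OF S]] by auto
qed

section \<open>Dilations\<close>
lemma dilation_derivs:
  assumes holf: "f holomorphic_on ball 0 1" and r: "0 < r" "r \<le> 1" and z: "norm z < 1"
  defines "F \<equiv> \<lambda>z. f (of_real r * z) / of_real r"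
  shows "(F has_field_derivative deriv f (of_real r * z)) (at z)"
    and "deriv F z = deriv f (of_real r * z)"
    and "deriv (deriv F) z = of_real r * deriv (deriv f) (of_real r * z)"
proof -
  have in1: "of_real r * z \<in> ball 0 1" if "norm z < 1" for z :: complex
    using that r mult_left_le_one_le[of "norm z" r] by (simp add: norm_mult)
  have dlin: "((\<lambda>z. of_real r * z) has_field_derivative of_real r) (at z)" for z :: complex
    by (auto intro!: derivative_eq_intros)
  have dF: "(F has_field_derivative deriv f (of_real r * z)) (at z)" if "norm z < 1" for z
    using DERIV_cdivide[OF DERIV_chain2[OF holomorphic_derivI[OF holf open_ball in1[OF that]] dlin], of "of_real r"] r
    unfolding F_def by simp
  then show "(F has_field_derivative deriv f (of_real r * z)) (at z)" "deriv F z = deriv f (of_real r * z)"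
    using z DERIV_imp_deriv by blast+
  have "((\<lambda>z. deriv f (of_real r * z)) has_field_derivative
      deriv (deriv f) (of_real r * z) * of_real r) (at z)"
    by (rule DERIV_chain2[OF holomorphic_derivI[OF holomorphic_deriv[OF holf open_ball] open_ball in1[OF z]] dlin])
  then have "(deriv F has_field_derivative deriv (deriv f) (of_real r * z) * of_real r) (at z)"
    by (rule has_field_derivative_transform_within_open[OF _ open_ball[of 0 1]])
      (use z in \<open>simp_all add: DERIV_imp_deriv[OF dF]\<close>)
  then show "deriv (deriv F) z = of_real r * deriv (deriv f) (of_real r * z)"
    by (simp add: DERIV_imp_deriv mult.commute)
qed

lemma dilation_in_class_S:
  assumes f: "f \<in> class_A" and r: "0 < r" "r \<le> 1" and inj: "inj_on f (ball 0 r)"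
  shows "(\<lambda>z. f (of_real r * z) / of_real r) \<in> class_S"
proof -
  define F where "F = (\<lambda>z. f (of_real r * z) / of_real r)"
  have holf: "f holomorphic_on ball 0 1" and f0: "f 0 = 0" "deriv f 0 = 1"
    using f by (auto simp: class_A_def)
  note dF = dilation_derivs[OF holf r, folded F_def]
  have "F holomorphic_on ball 0 1"
    using dF(1) unfolding holomorphic_on_open[OF open_ball] by force
  moreover have "F 0 = 0" "deriv F 0 = 1" using f0 dF(2)[of 0] by (auto simp: F_def)
  moreover have "inj_on F (ball 0 1)"
  proof (rule inj_onI)
    fix x y assume "x \<in> ball 0 1" "y \<in> ball 0 1" "F x = F y"
    then show "x = y"
      using r inj_onD[OF inj, of "of_real r * x" "of_real r * y"] by (auto simp: F_def norm_mult)
  qed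
  ultimately show ?thesis by (simp add: class_S_def class_A_def F_def)
qed

lemma of_real_scaling_onto_ball:
  assumes "0 < r" "norm u < r"
  obtains z :: complex where "norm z < 1" "u = of_real r * z"
proof
  show "norm (u / of_real r) < 1" using assms by (simp add: norm_divide)
  show "u = of_real r * (u / of_real r)" using assms by simp
qed

lemma dilation_convex_of_order_iff:
  assumes f: "f \<in> class_A" and r: "0 < r" "r \<le> 1"
    and S: "(\<lambda>z. f (of_real r * z) / of_real r) \<in> class_S"
  shows "(\<lambda>z. f (of_real r * z) / of_real r) \<in> convex_of_order \<alpha> \<longleftrightarrow>
    (\<forall>u. norm u < r \<longrightarrow> Re (1 + u * deriv (deriv f) u / deriv f u) > \<alpha>)"
proof -
  have holf: "f holomorphic_on ball 0 1" using f by (auto simp: class_A_def)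
  have "(\<forall>u. norm u < r \<longrightarrow> Re (1 + u * deriv (deriv f) u / deriv f u) > \<alpha>) \<longleftrightarrow>
    (\<forall>z. norm z < 1 \<longrightarrow> Re (1 + (of_real r * z) * deriv (deriv f) (of_real r * z) / deriv f (of_real r * z)) > \<alpha>)"
    (is "(\<forall>u. _ \<longrightarrow> ?P u) = (\<forall>z. _ \<longrightarrow> ?P (of_real r * z))")
  proof (intro iffI allI impI)
    fix u :: complex assume P: "\<forall>z. norm z < 1 \<longrightarrow> ?P (of_real r * z)" and u: "norm u < r"
    from u obtain z where "norm z < 1" "u = of_real r * z"
      by (rule of_real_scaling_onto_ball[OF r(1)])
    then show "?P u" using P by blast
  qed (use r in \<open>auto simp: norm_mult\<close>)
  then show ?thesis
    using S dilation_derivs(2,3)[OF holf r] by (simp add: convex_of_order_def Ball_def mult_ac)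
qed

lemma dilation_UCV_iff:
  assumes f: "f \<in> class_A" and r: "0 < r" "r \<le> 1"
    and S: "(\<lambda>z. f (of_real r * z) / of_real r) \<in> class_S"
  shows "(\<lambda>z. f (of_real r * z) / of_real r) \<in> class_UCV \<longleftrightarrow>
    (\<forall>u v. norm u < r \<longrightarrow> norm v < r \<longrightarrow> Re (1 + (u - v) * deriv (deriv f) u / deriv f u) \<ge> 0)"
proof -
  have holf: "f holomorphic_on ball 0 1" using f by (auto simp: class_A_def)
  have sc: "norm (of_real r * z) < r" if "norm z < 1" for z :: complex
    using that r by (simp add: norm_mult)
  have "(\<forall>u v. norm u < r \<longrightarrow> norm v < r \<longrightarrow> Re (1 + (u - v) * deriv (deriv f) u / deriv f u) \<ge> 0) \<longleftrightarrow>
    (\<forall>z \<zeta>. norm z < 1 \<longrightarrow> norm \<zeta> < 1 \<longrightarrow>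
      Re (1 + (of_real r * z - of_real r * \<zeta>) * deriv (deriv f) (of_real r * z) / deriv f (of_real r * z)) \<ge> 0)"
    (is "(\<forall>u v. _ \<longrightarrow> _ \<longrightarrow> ?P u v) = (\<forall>z \<zeta>. _ \<longrightarrow> _ \<longrightarrow> ?P (of_real r * z) (of_real r * \<zeta>))")
  proof (intro iffI allI impI)
    fix u v :: complex assume P: "\<forall>z \<zeta>. norm z < 1 \<longrightarrow> norm \<zeta> < 1 \<longrightarrow> ?P (of_real r * z) (of_real r * \<zeta>)"
      and u: "norm u < r" and v: "norm v < r"
    from u obtain z where "norm z < 1" "u = of_real r * z"
      by (rule of_real_scaling_onto_ball[OF r(1)])
    moreover from v obtain \<zeta> where "norm \<zeta> < 1" "v = of_real r * \<zeta>"
      by (rule of_real_scaling_onto_ball[OF r(1)])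
    ultimately show "?P u v" using P by blast
  qed (use sc in blast)
  then show ?thesis
    using S dilation_derivs(2,3)[OF holf r] by (auto simp: class_UCV_iff algebra_simps)
qed

section \<open>Estimates in the class \<open>class_F8\<close>\<close>

text \<open>
  Writing \<open>f' = g' (1 + w)\<close> splits \<open>1 + z f'' / f'\<close> into \<open>1 + z g'' / g'\<close>, which has positive
  real part, and \<open>z w' / (1 + w)\<close>. The radii of the two discs add up.
\<close>
lemma F8_disc:
  assumes f: "f \<in> class_F8" and z: "norm z < 1"
  shows "deriv f z \<noteq> 0"
    and "norm (1 + z * deriv (deriv f) z / deriv f z - of_real ((1 + (norm z)\<^sup>2) / (1 - (norm z)\<^sup>2)))
      \<le> (3 * norm z + (norm z)\<^sup>2) / (1 - (norm z)\<^sup>2)"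
proof -
  define r where "r = norm z"
  have r: "0 \<le> r" "r < 1" "r\<^sup>2 < 1" using z by (auto simp: r_def abs_square_less_1)
  obtain g where g: "g \<in> convex_functions"
    and fg: "\<And>z. norm z < 1 \<Longrightarrow> cmod (deriv f z / deriv g z - 1) < 1"
    using f by (auto simp: class_F8_def)
  have holf: "f holomorphic_on ball 0 1" and f1: "deriv f 0 = 1"
    using f by (auto simp: class_F8_def class_A_def)
  have gS: "g \<in> class_S" using g by (simp add: convex_functions_def)
  have holg: "g holomorphic_on ball 0 1" and g1: "deriv g 0 = 1"
    using gS by (auto simp: class_S_def class_A_def)
  have holf': "deriv f holomorphic_on ball 0 1" and holg': "deriv g holomorphic_on ball 0 1"
    by (intro holomorphic_deriv holf holg open_ball)+
  have gnz: "deriv g z \<noteq> 0" if "norm z < 1" for z by (rule class_S_deriv_nonzero[OF gS that])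
  define w where "w = (\<lambda>z. deriv f z / deriv g z - 1)"
  have holw: "w holomorphic_on ball 0 1"
    unfolding w_def by (intro holomorphic_intros holf' holg') (use gnz in auto)
  have w0: "w 0 = 0" by (simp add: w_def f1 g1)
  have w1: "norm (w z) < 1" if "norm z < 1" for z using fg[OF that] by (simp add: w_def)
  have f': "deriv f z = deriv g z * (1 + w z)" if "norm z < 1" for z
    using gnz[OF that] by (simp add: w_def)
  have wnz: "1 + w z \<noteq> 0"
    using w1[OF z] by (metis add.inverse_inverse less_irrefl add_eq_0_iff norm_minus_cancel norm_one)
  show fnz: "deriv f z \<noteq> 0" using f'[OF z] gnz[OF z] wnz by simp
  have zb: "z \<in> ball 0 1" using z by simp
  have "((\<lambda>z. deriv g z * (1 + w z)) has_field_derivative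
      deriv (deriv g) z * (1 + w z) + deriv w z * deriv g z) (at z)"
    using DERIV_mult[OF holomorphic_derivI[OF holg' open_ball zb]
        DERIV_add[OF DERIV_const holomorphic_derivI[OF holw open_ball zb]]] by simp
  then have "(deriv f has_field_derivative deriv (deriv g) z * (1 + w z) + deriv w z * deriv g z) (at z)"
    by (rule has_field_derivative_transform_within_open[OF _ open_ball zb]) (simp add: f')
  then have f'': "deriv (deriv f) z = deriv (deriv g) z * (1 + w z) + deriv w z * deriv g z"
    by (rule DERIV_imp_deriv)
  define p where "p = (\<lambda>z. 1 + z * deriv (deriv g) z / deriv g z)"
  have split: "1 + z * deriv (deriv f) z / deriv f z = p z + z * deriv w z / (1 + w z)"
  proof -
    have "z * (c * B + d * A) / (A * B) = z * c / A + z * d / B"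
      if "A \<noteq> 0" "B \<noteq> 0" for A B c d :: complex
      using that by (simp add: field_simps)
    from this[OF gnz[OF z] wnz] show ?thesis
      unfolding f'' f'[OF z] p_def by simp
  qed
  have "norm (p z - of_real ((1 + r\<^sup>2) / (1 - r\<^sup>2))) \<le> 2 * r / (1 - r\<^sup>2)"
    unfolding r_def
  proof (rule Caratheodory_disc[OF _ _ _ z])
    show "p holomorphic_on ball 0 1"
      unfolding p_def by (intro holomorphic_intros holomorphic_deriv holg' holg open_ball) (use gnz in auto)
    show "Re (p z) > 0" if "norm z < 1" for z
      using g that by (simp add: p_def convex_functions_def)
  qed (simp add: p_def)
  moreover have "norm (z * deriv w z / (1 + w z)) \<le> r / (1 - r)"
    unfolding r_def by (rule logarithmic_derivative_one_plus_bound[OF holw w0 w1 z])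
  moreover have "2 * r / (1 - r\<^sup>2) + r / (1 - r) = (3 * r + r\<^sup>2) / (1 - r\<^sup>2)"
  proof -
    have "1 - r\<^sup>2 = (1 - r) * (1 + r)" by (simp add: power2_eq_square algebra_simps)
    then show ?thesis using r by (simp add: divide_simps power2_eq_square) (simp add: algebra_simps)
  qed
  moreover have "1 + z * deriv (deriv f) z / deriv f z - of_real ((1 + r\<^sup>2) / (1 - r\<^sup>2))
     = (p z - of_real ((1 + r\<^sup>2) / (1 - r\<^sup>2))) + z * deriv w z / (1 + w z)"
    unfolding split by simp
  ultimately show "norm (1 + z * deriv (deriv f) z / deriv f z - of_real ((1 + (norm z)\<^sup>2) / (1 - (norm z)\<^sup>2)))
      \<le> (3 * norm z + (norm z)\<^sup>2) / (1 - (norm z)\<^sup>2)"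
    unfolding r_def[symmetric] using norm_triangle_ineq by (smt (verit))
qed

lemma F8_Re_lower_bound:
  assumes f: "f \<in> class_F8" and z: "norm z < 1"
  shows "Re (1 + z * deriv (deriv f) z / deriv f z) \<ge> (1 - 3 * norm z) / (1 - (norm z)\<^sup>2)"
proof -
  define r where "r = norm z"
  define W where "W = 1 + z * deriv (deriv f) z / deriv f z"
  have "\<bar>Re W - (1 + r\<^sup>2) / (1 - r\<^sup>2)\<bar> \<le> (3 * r + r\<^sup>2) / (1 - r\<^sup>2)"
    using order_trans[OF abs_Re_le_cmod F8_disc(2)[OF f z]] by (simp add: r_def W_def)
  then have "Re W \<ge> (1 + r\<^sup>2) / (1 - r\<^sup>2) - (3 * r + r\<^sup>2) / (1 - r\<^sup>2)" by linarith
  also have "(1 + r\<^sup>2) / (1 - r\<^sup>2) - (3 * r + r\<^sup>2) / (1 - r\<^sup>2) = (1 - 3 * r) / (1 - r\<^sup>2)"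
    by (simp add: diff_divide_distrib[symmetric])
  finally show ?thesis by (simp add: r_def W_def)
qed

lemma F8_inj_on_third_disc:
  assumes f: "f \<in> class_F8"
  shows "inj_on f (ball 0 (1/3))"
proof (rule univalent_on_third_disc)
  show "f holomorphic_on ball 0 1" "deriv f 0 = 1" using f by (auto simp: class_F8_def class_A_def)
  show "deriv f z \<noteq> 0" if "norm z < 1" for z by (rule F8_disc(1)[OF f that])
  show "norm (z * deriv (deriv f) z / deriv f z) \<le> 3 * norm z / (1 - norm z)" if z: "norm z < 1" for z
  proof -
    define r where "r = norm z"
    have r: "0 \<le> r" "r < 1" "r\<^sup>2 < 1" using z by (auto simp: r_def abs_square_less_1)
    define q a where "q = z * deriv (deriv f) z / deriv f z" and "a = (1 + r\<^sup>2) / (1 - r\<^sup>2)"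
    have "a - 1 = 2 * r\<^sup>2 / (1 - r\<^sup>2)" using r by (simp add: a_def field_simps)
    moreover have "0 \<le> 2 * r\<^sup>2 / (1 - r\<^sup>2)" using r by simp
    ultimately have "norm (of_real (a - 1) :: complex) = 2 * r\<^sup>2 / (1 - r\<^sup>2)"
      unfolding norm_of_real by linarith
    moreover have "norm (1 + q - of_real a) \<le> (3 * r + r\<^sup>2) / (1 - r\<^sup>2)"
      using F8_disc(2)[OF f z] by (simp add: q_def a_def r_def)
    moreover have "q = (1 + q - of_real a) + of_real (a - 1)" by simp
    then have "norm q \<le> norm (1 + q - of_real a) + norm (of_real (a - 1) :: complex)"
      by (metis norm_triangle_ineq)
    ultimately have "norm q \<le> (3 * r + r\<^sup>2) / (1 - r\<^sup>2) + 2 * r\<^sup>2 / (1 - r\<^sup>2)" by linarith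
    also have "\<dots> = 3 * r / (1 - r)"
    proof -
      have "1 - r\<^sup>2 = (1 - r) * (1 + r)" by (simp add: power2_eq_square algebra_simps)
      then show ?thesis using r by (simp add: divide_simps power2_eq_square) (simp add: algebra_simps)
    qed
    finally show ?thesis by (simp add: q_def r_def)
  qed
qed

text \<open>
  If \<open>\<bar>v\<bar> \<le> \<bar>u\<bar>\<close> then it is enough that \<open>W = 1 + u f'' / f'\<close> satisfies
  \<open>\<bar>W - 1\<bar> \<le> Re W\<close>, which holds because the disc that contains \<open>W\<close> lies inside the parabola. If
  \<open>\<bar>v\<bar> > \<bar>u\<bar>\<close>, the bound on the circle through \<open>v\<close> is carried to its interior by the minimum
  principle, with \<open>v\<close> fixed.
\<close>
lemma F8_curvature_nonneg:
  assumes f: "f \<in> class_F8" and u: "norm u < 3 - 2 * sqrt 2" and v: "norm v < 3 - 2 * sqrt 2"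
  shows "Re (1 + (u - v) * deriv (deriv f) u / deriv f u) \<ge> 0"
proof -
  define s where "s = max (norm u) (norm v)"
  have s: "0 \<le> s" "s < 3 - 2 * sqrt 2" using u v by (auto simp: s_def le_max_iff_disj)
  have "1.4 < sqrt 2" by (rule real_less_rsqrt) (simp add: power2_eq_square)
  \<comment> \<open>This gives \<open>s\<^sup>2 < 1/5\<close>, which is what puts the centre \<open>a\<close> of the disc below \<open>3/2\<close>.\<close>
  then have s5: "s < 1/5" using s by linarith
  have "s\<^sup>2 < (1/5)\<^sup>2" using s s5 by (intro power_strict_mono) auto
  then have s2: "s\<^sup>2 < 1/5" by (simp add: power2_eq_square)
  \<comment> \<open>The bound on \<open>s\<close> is the smaller root of \<open>s\<^sup>2 - 6 s + 1 = (3 - s)\<^sup>2 - 8\<close>.\<close>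
  have s8: "6 * s \<le> 1 + s\<^sup>2"
  proof -
    have "(2 * sqrt 2)\<^sup>2 \<le> (3 - s)\<^sup>2" using s by (intro power_mono) auto
    then show ?thesis by (simp add: power2_eq_square algebra_simps)
  qed
  have holf: "f holomorphic_on ball 0 1" using f by (auto simp: class_F8_def class_A_def)
  show ?thesis
  proof (rule Re_nonneg_minimum_principle[where U = "ball 0 1" and s = s and u = u])
    show "(\<lambda>u. 1 + (u - v) * deriv (deriv f) u / deriv f u) holomorphic_on ball 0 1"
      by (intro holomorphic_intros holomorphic_deriv holf open_ball) (use F8_disc(1)[OF f] in auto)
    show "cball 0 s \<subseteq> ball (0::complex) 1" using s5 by auto
    fix u :: complex assume us: "norm u = s"
    define q W a where "q = deriv (deriv f) u / deriv f u" and "W = 1 + u * q"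
      and "a = (1 + s\<^sup>2) / (1 - s\<^sup>2)"
    have "norm (W - of_real a) \<le> (3 * s + s\<^sup>2) / (1 - s\<^sup>2)"
      using F8_disc(2)[OF f, of u] us s5 by (simp add: W_def q_def a_def)
    also have "\<dots> \<le> a - 1/2"
    proof -
      have "a - 1/2 = (1/2 + 3/2 * s\<^sup>2) / (1 - s\<^sup>2)" using s2 unfolding a_def by (simp add: field_simps)
      then show ?thesis using s2 s8 by (simp add: divide_right_mono)
    qed
    finally have "norm (W - of_real a) \<le> a - 1/2" .
    moreover have "a \<le> 3/2" using s2 unfolding a_def by (simp add: field_simps)
    ultimately have "norm (W - 1) \<le> Re W" by (rule disc_inside_parabola)
    moreover have "norm (v * q) \<le> norm (W - 1)"
      using us by (auto simp: W_def norm_mult s_def intro!: mult_right_mono)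
    moreover have "Re (v * q) \<le> norm (v * q)" by (rule complex_Re_le_cmod)
    ultimately have "Re (W - v * q) \<ge> 0" by simp
    then show "Re (1 + (u - v) * deriv (deriv f) u / deriv f u) \<ge> 0"
      by (simp add: W_def q_def algebra_simps diff_divide_distrib)
  qed (auto simp: s_def)
qed

section \<open>The extremal function\<close>

text \<open>
  The primitive of \<open>(1 + z) / (1 - z)\<^sup>2\<close> that vanishes at the origin. It takes both summands of
  \<open>1 + z f'' / f'\<close> to their extreme values at the same points, the negative real ones: there
  \<open>g z = z / (1 - z)\<close> is extremal among convex functions, and \<open>w z = z\<close> in the estimate for
  \<open>z w' / (1 + w)\<close>.
\<close>
definition F8_extremal :: "complex \<Rightarrow> complex" where
  "F8_extremal z = 2 * z / (1 - z) + Ln (1 - z)"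

lemma F8_extremal_derivs:
  assumes z: "norm z < 1"
  shows "(F8_extremal has_field_derivative (1 + z) / (1 - z)\<^sup>2) (at z)"
    and "deriv F8_extremal z = (1 + z) / (1 - z)\<^sup>2"
    and "deriv (deriv F8_extremal) z = (3 + z) / (1 - z) ^ 3"
proof -
  have nz: "1 - z \<noteq> 0" if "norm z < 1" for z :: complex using that by auto
  have np: "1 - z \<notin> \<real>\<^sub>\<le>\<^sub>0" if "norm z < 1" for z :: complex
    using that complex_Re_le_cmod[of z] by (auto simp: complex_nonpos_Reals_iff)
  have d1: "(F8_extremal has_field_derivative (1 + z) / (1 - z)\<^sup>2) (at z)" if "norm z < 1" for z
  proof -
    have "((\<lambda>z. 2 * z / (1 - z)) has_field_derivative 2 / (1 - z)\<^sup>2) (at z)"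
      using nz[OF that] by (auto intro!: derivative_eq_intros simp: power2_eq_square algebra_simps)
    moreover have "((\<lambda>z. Ln (1 - z)) has_field_derivative - 1 / (1 - z)) (at z)"
      using nz[OF that] np[OF that] by (auto intro!: derivative_eq_intros simp: inverse_eq_divide)
    ultimately have "(F8_extremal has_field_derivative 2 / (1 - z)\<^sup>2 + - 1 / (1 - z)) (at z)"
      unfolding F8_extremal_def [abs_def] by (rule DERIV_add)
    also have "2 / (1 - z)\<^sup>2 + - 1 / (1 - z) = (1 + z) / (1 - z)\<^sup>2"
      using nz[OF that] by (simp add: divide_simps power2_eq_square) (simp add: algebra_simps)
    finally show ?thesis .
  qed
  then show "(F8_extremal has_field_derivative (1 + z) / (1 - z)\<^sup>2) (at z)"
    "deriv F8_extremal z = (1 + z) / (1 - z)\<^sup>2"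
    using z DERIV_imp_deriv by blast+
  have "((\<lambda>z. (1 + z) / (1 - z)\<^sup>2) has_field_derivative (3 + z) / (1 - z) ^ 3) (at z)"
    using nz[OF z]
    by (auto intro!: derivative_eq_intros simp: divide_simps) (simp add: eval_nat_numeral algebra_simps)
  then have "(deriv F8_extremal has_field_derivative (3 + z) / (1 - z) ^ 3) (at z)"
    by (rule has_field_derivative_transform_within_open[OF _ open_ball[of 0 1]])
      (use z in \<open>simp_all add: DERIV_imp_deriv[OF d1]\<close>)
  then show "deriv (deriv F8_extremal) z = (3 + z) / (1 - z) ^ 3" by (rule DERIV_imp_deriv)
qed

text \<open>
  This map sends the disc onto the half plane \<open>Re > - 1/2\<close>.
\<close>
lemma half_plane_map_convex: "(\<lambda>z. z / (1 - z)) \<in> convex_functions"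
  and deriv_half_plane_map: "\<And>z. norm z < 1 \<Longrightarrow> deriv (\<lambda>z::complex. z / (1 - z)) z = 1 / (1 - z)\<^sup>2"
proof -
  define g where "g = (\<lambda>z::complex. z / (1 - z))"
  have nz: "1 - z \<noteq> 0" if "norm z < 1" for z :: complex using that by auto
  have d1: "(g has_field_derivative 1 / (1 - z)\<^sup>2) (at z)" if "norm z < 1" for z
    unfolding g_def using nz[OF that]
    by (auto intro!: derivative_eq_intros simp: divide_simps power2_eq_square)
  have d2: "deriv (deriv g) z = 2 / (1 - z) ^ 3" if z: "norm z < 1" for z
  proof -
    have "((\<lambda>z. 1 / (1 - z)\<^sup>2) has_field_derivative 2 / (1 - z) ^ 3) (at z)"
      using nz[OF z]
      by (auto intro!: derivative_eq_intros simp: divide_simps) (simp add: eval_nat_numeral algebra_simps)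
    then have "(deriv g has_field_derivative 2 / (1 - z) ^ 3) (at z)"
      by (rule has_field_derivative_transform_within_open[OF _ open_ball[of 0 1]])
        (use z in \<open>simp_all add: DERIV_imp_deriv[OF d1]\<close>)
    then show ?thesis by (rule DERIV_imp_deriv)
  qed
  show "deriv (\<lambda>z::complex. z / (1 - z)) z = 1 / (1 - z)\<^sup>2" if "norm z < 1" for z
    using DERIV_imp_deriv[OF d1[OF that]] by (simp add: g_def)
  have "g holomorphic_on ball 0 1" unfolding g_def by (intro holomorphic_intros) auto
  moreover have "inj_on g (ball 0 1)"
  proof (rule inj_onI)
    fix x y assume "x \<in> ball 0 1" "y \<in> ball 0 1" "g x = g y"
    then show "x = y" using nz[of x] nz[of y] by (simp add: g_def field_simps)
  qed
  ultimately have "g \<in> class_S"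
    using DERIV_imp_deriv[OF d1[of 0]] by (simp add: class_S_def class_A_def g_def)
  moreover have "Re (1 + z * deriv (deriv g) z / deriv g z) > 0" if z: "z \<in> ball 0 1" for z
  proof -
    have z1: "norm z < 1" using z by simp
    have eq: "1 + z * deriv (deriv g) z / deriv g z = (1 + z) / (1 - z)"
      unfolding d2[OF z1] DERIV_imp_deriv[OF d1[OF z1]] using nz[OF z1]
      by (simp add: divide_simps power2_eq_square power3_eq_cube)
    have "(norm z)\<^sup>2 < 1" using z1 by (simp add: abs_square_less_1)
    then have "0 < Re (1 + z) * Re (1 - z) + Im (1 + z) * Im (1 - z)"
      unfolding cmod_power2 by (simp add: power2_eq_square algebra_simps)
    moreover have "0 < (Re (1 - z))\<^sup>2 + (Im (1 - z))\<^sup>2"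
      using nz[OF z1] complex_neq_0 by blast
    ultimately have "Re ((1 + z) / (1 - z)) > 0"
      unfolding Re_divide by (rule divide_pos_pos)
    then show ?thesis unfolding eq .
  qed
  ultimately show "(\<lambda>z. z / (1 - z)) \<in> convex_functions" by (simp add: convex_functions_def g_def)
qed

lemma F8_extremal_in_F8: "F8_extremal \<in> class_F8"
proof -
  have "F8_extremal holomorphic_on ball 0 1"
    using F8_extremal_derivs(1) unfolding holomorphic_on_open[OF open_ball] by force
  then have "F8_extremal \<in> class_A"
    using F8_extremal_derivs(2)[of 0] by (simp add: class_A_def F8_extremal_def)
  moreover have "cmod (deriv F8_extremal z / deriv (\<lambda>z. z / (1 - z)) z - 1) < 1" if "norm z < 1" for z
  proof -
    have "1 - z \<noteq> 0" using that by auto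
    then show ?thesis using F8_extremal_derivs(2)[OF that] deriv_half_plane_map[OF that] that by simp
  qed
  ultimately show ?thesis using half_plane_map_convex unfolding class_F8_def by (intro CollectI conjI bexI ballI) simp_all
qed

lemma F8_extremal_on_negative_axis:
  assumes "0 \<le> x" "x < 1"
  shows "1 + (- of_real x) * deriv (deriv F8_extremal) (- of_real x) / deriv F8_extremal (- of_real x)
    = of_real ((1 - 3 * x) / (1 - x\<^sup>2))"
proof -
  have alg: "1 + (- t) * ((3 + - t) / (1 - - t) ^ 3) / ((1 + - t) / (1 - - t)\<^sup>2) = (1 - 3 * t) / (1 - t\<^sup>2)"
    if "1 + t \<noteq> 0" "1 - t \<noteq> 0" for t :: complex
  proof -
    have "1 - t\<^sup>2 = (1 - t) * (1 + t)" by (simp add: power2_eq_square algebra_simps)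
    then show ?thesis using that
      by (simp add: divide_simps) (simp add: eval_nat_numeral algebra_simps)
  qed
  have "1 + complex_of_real x \<noteq> 0" "1 - complex_of_real x \<noteq> 0"
    using assms by (auto simp: complex_eq_iff)
  from alg[OF this] show ?thesis
    using assms by (simp add: F8_extremal_derivs(2,3))
qed

section \<open>The radii\<close>

text \<open>
  \<open>R\<close> is the root in the unit interval of \<open>\<alpha> x\<^sup>2 - 3 x + 1 - \<alpha>\<close>, in a form that also covers
  \<open>\<alpha> = 0\<close>. The quadratic factors as \<open>(R - x) (3 - \<alpha> (x + R))\<close>, and the second factor is positive
  on the unit interval.
\<close>
lemma order_radius:
  fixes \<alpha> :: real
  assumes \<alpha>: "0 \<le> \<alpha>" "\<alpha> < 1"
  defines "R \<equiv> 2 * (1 - \<alpha>) / (3 + sqrt (9 + 4 * \<alpha> * (\<alpha> - 1)))"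
  shows "0 < R" "R \<le> 1/3"
    and "\<And>x. 0 \<le> x \<Longrightarrow> x < 1 \<Longrightarrow> \<alpha> < (1 - 3 * x) / (1 - x\<^sup>2) \<longleftrightarrow> x < R"
    and "\<And>x. 0 \<le> x \<Longrightarrow> x < 1 \<Longrightarrow> \<alpha> \<le> (1 - 3 * x) / (1 - x\<^sup>2) \<longleftrightarrow> x \<le> R"
proof -
  define D where "D = sqrt (9 + 4 * \<alpha> * (\<alpha> - 1))"
  have "0 \<le> (2 * \<alpha> - 1)\<^sup>2" by simp
  then have pos: "0 \<le> 9 + 4 * \<alpha> * (\<alpha> - 1)" by (simp add: power2_eq_square algebra_simps)
  have D: "0 \<le> D" "D * D = 9 + 4 * \<alpha> * (\<alpha> - 1)" using pos by (auto simp: D_def)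
  have R: "R * (3 + D) = 2 * (1 - \<alpha>)" using D(1) unfolding R_def D_def[symmetric] by simp
  show R0: "0 < R" using \<alpha> D unfolding R_def D_def[symmetric] by (intro divide_pos_pos) auto
  have root: "\<alpha> * R\<^sup>2 - 3 * R + 1 - \<alpha> = 0"
  proof -
    have "(\<alpha> * R\<^sup>2 - 3 * R + 1 - \<alpha>) * (3 + D)\<^sup>2
        = \<alpha> * (R * (3 + D))\<^sup>2 - 3 * (R * (3 + D)) * (3 + D) + (1 - \<alpha>) * (3 + D)\<^sup>2"
      by (simp add: power2_eq_square algebra_simps)
    also have "\<dots> = (1 - \<alpha>) * (4 * \<alpha> * (1 - \<alpha>) - 9 + D * D)"
      unfolding R by (simp add: power2_eq_square algebra_simps)
    also have "\<dots> = 0" unfolding D(2) by (simp add: algebra_simps)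
    finally show ?thesis using D(1) by simp
  qed
  have "R \<le> 1"
  proof -
    have "R * 2 \<le> R * (3 + D)" using R0 D(1) by (intro mult_left_mono) auto
    then show ?thesis using R \<alpha> by simp
  qed
  then have "R\<^sup>2 \<le> 1" using R0 by (simp add: power_le_one)
  then have "0 \<le> \<alpha> * (1 - R\<^sup>2)" using \<alpha> by simp
  then show R3: "R \<le> 1/3" using root by (simp add: algebra_simps)
  fix x :: real assume x: "0 \<le> x" "x < 1"
  have x2: "0 < 1 - x\<^sup>2" using x by (simp add: abs_square_less_1)
  have "\<alpha> * (x + R) \<le> 1 * (x + R)" using \<alpha> x R0 by (intro mult_right_mono) auto
  then have neg: "0 < 3 - \<alpha> * (x + R)" using x R3 unfolding mult_1 by linarith
  have "\<alpha> * x\<^sup>2 - 3 * x + 1 - \<alpha> = (R - x) * (3 - \<alpha> * (x + R))"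
    using root by (simp add: power2_eq_square algebra_simps)
  then have "(1 - 3 * x) - \<alpha> * (1 - x\<^sup>2) = (R - x) * (3 - \<alpha> * (x + R))"
    by (simp add: algebra_simps)
  moreover have "0 < (R - x) * (3 - \<alpha> * (x + R)) \<longleftrightarrow> x < R" "0 \<le> (R - x) * (3 - \<alpha> * (x + R)) \<longleftrightarrow> x \<le> R"
    using neg by (simp_all add: zero_less_mult_iff zero_le_mult_iff)
  ultimately show "\<alpha> < (1 - 3 * x) / (1 - x\<^sup>2) \<longleftrightarrow> x < R" "\<alpha> \<le> (1 - 3 * x) / (1 - x\<^sup>2) \<longleftrightarrow> x \<le> R"
    unfolding pos_less_divide_eq[OF x2] pos_le_divide_eq[OF x2] by linarith+
qed

lemma order_radius_half:
  "2 * (1 - 1/2) / (3 + sqrt (9 + 4 * (1/2) * (1/2 - 1))) = 3 - 2 * sqrt (2::real)"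
proof -
  have "sqrt 8 = 2 * sqrt (2::real)" using real_sqrt_mult[of 4 2] by simp
  have "(3 - 2 * sqrt 2) * (3 + 2 * sqrt 2) = (1::real)" by (simp add: algebra_simps)
  moreover have "3 + 2 * sqrt 2 \<noteq> (0::real)" by (smt (verit) real_sqrt_ge_zero)
  ultimately have "1 / (3 + 2 * sqrt 2) = 3 - 2 * sqrt (2::real)" by (simp add: nonzero_divide_eq_eq)
  with \<open>sqrt 8 = 2 * sqrt 2\<close> show ?thesis by simp
qed

lemma F8_dilation_in_class_S:
  assumes "f \<in> class_F8" "0 < r" "r \<le> 1/3"
  shows "(\<lambda>z. f (of_real r * z) / of_real r) \<in> class_S"
proof (rule dilation_in_class_S)
  show "f \<in> class_A" using assms by (simp add: class_F8_def)
  show "inj_on f (ball 0 r)"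
    using F8_inj_on_third_disc[OF assms(1)] by (rule inj_on_subset) (use assms in auto)
qed (use assms in auto)

text \<open>
  The lower bound for the real part and its value for the extremal function at \<open>-R\<close> agree. If a
  larger radius were admissible, the strict inequality would have to hold at \<open>-R\<close>, where it is an equality.
\<close>
lemma is_radius_convex_of_order_F8:
  assumes \<alpha>: "0 \<le> \<alpha>" "\<alpha> < 1"
  shows "is_radius (convex_of_order \<alpha>) class_F8 (2 * (1 - \<alpha>) / (3 + sqrt (9 + 4 * \<alpha> * (\<alpha> - 1))))"
proof -
  define R where "R = 2 * (1 - \<alpha>) / (3 + sqrt (9 + 4 * \<alpha> * (\<alpha> - 1)))"
  note R = order_radius[OF \<alpha>, folded R_def]
  have "(\<lambda>z. f (of_real r * z) / of_real r) \<in> convex_of_order \<alpha>"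
    if r: "0 < r" "r \<le> R" and f: "f \<in> class_F8" for r f
  proof -
    have "Re (1 + u * deriv (deriv f) u / deriv f u) > \<alpha>" if u: "norm u < r" for u
      using F8_Re_lower_bound[OF f, of u] R(3)[of "norm u"] u r R(2) by auto
    then show ?thesis
      using F8_dilation_in_class_S[OF f, of r] f r R(2)
      by (subst dilation_convex_of_order_iff) (auto simp: class_F8_def)
  qed
  moreover have "R' \<le> R" if adm: "admissible_radius (convex_of_order \<alpha>) class_F8 R'" for R'
  proof (rule ccontr)
    assume "\<not> R' \<le> R"
    then have R': "R < R'" "0 < R'" "R' \<le> 1" using R adm by (auto simp: admissible_radius_def)
    have F: "(\<lambda>z. F8_extremal (of_real R' * z) / of_real R') \<in> convex_of_order \<alpha>"
      using adm F8_extremal_in_F8 R' by (auto simp: admissible_radius_def)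
    then have "(\<lambda>z. F8_extremal (of_real R' * z) / of_real R') \<in> class_S"
      by (simp add: convex_of_order_def)
    with F have *: "\<forall>u. norm u < R' \<longrightarrow> Re (1 + u * deriv (deriv F8_extremal) u / deriv F8_extremal u) > \<alpha>"
      using dilation_convex_of_order_iff F8_extremal_in_F8 R' by (auto simp: class_F8_def)
    have "norm (- complex_of_real R) < R'" using R R' by simp
    from *[rule_format, OF this] have "\<alpha> < (1 - 3 * R) / (1 - R\<^sup>2)"
      using F8_extremal_on_negative_axis[of R] R by (simp only: Re_complex_of_real)
    then show False using R(3)[of R] R(1,2) by simp
  qed
  ultimately show ?thesis
    using R unfolding is_radius_def R_def[symmetric] by (auto simp: admissible_radius_def)
qed

text \<open>
  For sharpness take the point \<open>u = - x\<close> on the negative axis and the opposite centre \<open>v = x\<close>. Then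
  \<open>1 + (u - v) f'' / f' = 2 W - 1\<close> with \<open>W = 1 + u f'' / f'\<close>, so convexity of the arc requires
  \<open>Re W \<ge> 1/2\<close>: the condition for order \<open>1/2\<close>.
\<close>
lemma is_radius_UCV_F8: "is_radius class_UCV class_F8 (3 - 2 * sqrt 2)"
proof -
  define R where "R = 3 - 2 * sqrt (2::real)"
  note R = order_radius[of "1/2", unfolded order_radius_half, folded R_def, simplified]
  have "(\<lambda>z. f (of_real r * z) / of_real r) \<in> class_UCV"
    if r: "0 < r" "r \<le> R" and f: "f \<in> class_F8" for r f
  proof -
    have "Re (1 + (u - v) * deriv (deriv f) u / deriv f u) \<ge> 0" if "norm u < r" "norm v < r" for u v
      by (rule F8_curvature_nonneg[OF f]) (use that r in \<open>auto simp: R_def\<close>)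
    then show ?thesis
      using F8_dilation_in_class_S[OF f, of r] f r R(2)
      by (subst dilation_UCV_iff) (auto simp: class_F8_def)
  qed
  moreover have "R' \<le> R" if adm: "admissible_radius class_UCV class_F8 R'" for R'
  proof (rule ccontr)
    assume "\<not> R' \<le> R"
    then have R': "R < R'" "0 < R'" "R' \<le> 1" using R adm by (auto simp: admissible_radius_def)
    have F: "(\<lambda>z. F8_extremal (of_real R' * z) / of_real R') \<in> class_UCV"
      using adm F8_extremal_in_F8 R' by (auto simp: admissible_radius_def)
    then have "(\<lambda>z. F8_extremal (of_real R' * z) / of_real R') \<in> class_S"
      by (simp add: class_UCV_def)
    with F have *: "\<forall>u v. norm u < R' \<longrightarrow> norm v < R' \<longrightarrow>
        Re (1 + (u - v) * deriv (deriv F8_extremal) u / deriv F8_extremal u) \<ge> 0"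
      using dilation_UCV_iff F8_extremal_in_F8 R' by (auto simp: class_F8_def)
    \<comment> \<open>The condition for uniform convexity is not strict, so it has to be tested beyond \<open>R\<close>.\<close>
    define x where "x = (R + R') / 2"
    have x: "R < x" "x < R'" "0 < x" "x < 1" using R R' by (auto simp: x_def)
    define u W where "u = - complex_of_real x"
      and "W = 1 + u * deriv (deriv F8_extremal) u / deriv F8_extremal u"
    have W: "W = of_real ((1 - 3 * x) / (1 - x\<^sup>2))"
      using F8_extremal_on_negative_axis[of x] x by (simp add: W_def u_def)
    have "1 + (u - (- u)) * deriv (deriv F8_extremal) u / deriv F8_extremal u = 2 * W - 1"
      by (simp add: W_def)
    moreover have "norm u < R'" "norm (- u) < R'" using x by (simp_all add: u_def)
    ultimately have "0 \<le> Re (2 * W - 1)"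
      using *[rule_format, of u "- u"] by (simp only:)
    then have "1/2 \<le> (1 - 3 * x) / (1 - x\<^sup>2)" by (simp add: W)
    then show False using R(4)[of x] x by simp
  qed
  ultimately show ?thesis
    using R unfolding is_radius_def R_def[symmetric] by (auto simp: admissible_radius_def)
qed

theorem theorem3p3:
  shows "(\<forall>\<alpha>::real. 0 \<le> \<alpha> \<longrightarrow> \<alpha> < 1 \<longrightarrow>
            is_radius (convex_of_order \<alpha>) class_F8
              (2 * (1 - \<alpha>) / (3 + sqrt (9 + 4 * \<alpha> * (\<alpha> - 1)))))
       \<and> is_radius class_UCV class_F8 (3 - 2 * sqrt 2)
       \<and> is_radius (convex_of_order (1 / 2)) class_F8 (3 - 2 * sqrt 2)"
  using is_radius_convex_of_order_F8 is_radius_UCV_F8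
    is_radius_convex_of_order_F8[of "1/2", unfolded order_radius_half] by simp

end
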